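(* Let $\mathcal{M}$ be an oriented maniplex. Then $T(\mathcal{M})$ and $T^+(\mathcal{M})$ have the same number of vertices (equivalently, the number of $\mathrm{Aut}(\mathcal{M})$-orbits on flags equals the number of $\mathrm{Aut}^+(\mathcal{M})$-orbits on black flags) if and only if $T(\mathcal{M})$ has a semi-edge or a cycle of odd length.
   Context: A maniplex is given by a connected simple graph $\mathcal{G}_\mathcal{M}$ (flag graph), whose vertices are called flags, with a proper edge-colouring by colours $\{0,\dots,m\}$, each colour class a perfect matching, such that for colours $i,j$ with $|i-j|\ge2$ each component of the subgraph spanned by colours $i,j$ is a 4-cycle. Automorphisms are colour-preserving graph automorphisms. $\mathcal{M}$ is orientable if $\mathcal{G}_\mathcal{M}$ is bipartite; an oriented maniplex is an orientable one with a chosen 2-colouring (black/white) of the flags; $\mathrm{Aut}^+(\mathcal{M})$ is the group of automorphisms mapping black flags to black flags. The symmetry type graph $T(\mathcal{M})$ is the pregraph whose vertices are the $\mathrm{Aut}(\mathcal{M})$-orbits of flags, with an edge of colour $a$ between distinct orbits $B,C$ iff some flag of $B$ is $a$-adjacent to a flag of $C$, and a semi-edge of colour $a$ at $B$ iff some flag of $B$ is $a$-adjacent to a flag of $B$. The oriented symmetry type di-graph $T^+(\mathcal{M})$ is a quotient of the graph on the black flags whose vertices are the orbits of $\mathrm{Aut}^+(\mathcal{M})$ on the black flags.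
   Formalization: The formal statement assumes that T(M) has finitely many vertices (M itself may be infinite); when T(M) is infinite, both T(M) and T^+(M) are countably infinite, and the equivalence can fail, e.g. for a plane tree with pairwise distinct vertex degrees at least 3. *)

theory Defs
  imports "HOL-Algebra.Group_Action"
begin

section \<open>Simple graphs\<close>

text \<open>
  A simple graph is given by a set of vertices and a set of edges, each edge being the
  two-element set of its endpoints. Vertex sets may be infinite.
\<close>

definition simple_graph :: "'f set \<Rightarrow> 'f set set \<Rightarrow> bool" where
  "simple_graph V E \<longleftrightarrow> (\<forall>e\<in>E. e \<subseteq> V \<and> card e = 2)"

definition adj_rel :: "'f set set \<Rightarrow> ('f \<times> 'f) set" where
  "adj_rel E = {(u, v). {u, v} \<in> E}"

definition connected_graph :: "'f set \<Rightarrow> 'f set set \<Rightarrow> bool" where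
  "connected_graph V E \<longleftrightarrow> V \<noteq> {} \<and> (\<forall>u\<in>V. \<forall>v\<in>V. (u, v) \<in> (adj_rel E)\<^sup>*)"

definition component_verts :: "'f set set \<Rightarrow> 'f \<Rightarrow> 'f set" where
  "component_verts E v = (adj_rel E)\<^sup>* `` {v}"

definition component_edges :: "'f set set \<Rightarrow> 'f \<Rightarrow> 'f set set" where
  "component_edges E v = {e \<in> E. e \<subseteq> component_verts E v}"

definition four_cycle :: "'f set \<Rightarrow> 'f set set \<Rightarrow> bool" where
  "four_cycle V E \<longleftrightarrow>
     (\<exists>a b c d. distinct [a, b, c, d] \<and> V = {a, b, c, d} \<and>
        E = {{a, b}, {b, c}, {c, d}, {d, a}})"

definition perfect_matching :: "'f set \<Rightarrow> 'f set set \<Rightarrow> bool" where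
  "perfect_matching V F \<longleftrightarrow> (\<forall>v\<in>V. \<exists>!e. e \<in> F \<and> v \<in> e)"

definition bipartition :: "'f set \<Rightarrow> 'f set set \<Rightarrow> 'f set \<Rightarrow> 'f set \<Rightarrow> bool" where
  "bipartition V E X Y \<longleftrightarrow>
     X \<union> Y = V \<and> X \<inter> Y = {} \<and> (\<forall>e\<in>E. \<exists>x\<in>X. \<exists>y\<in>Y. e = {x, y})"

section \<open>Maniplexes\<close>

text \<open>Only the values of \<open>colour\<close> on edges are meaningful.\<close>

record 'f flag_graph =
  flags :: "'f set"
  edges :: "'f set set"
  colour :: "'f set \<Rightarrow> nat"

definition colour_class :: "'f flag_graph \<Rightarrow> nat \<Rightarrow> 'f set set" where
  "colour_class M i = {e \<in> edges M. colour M e = i}"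

locale maniplex =
  fixes m :: nat and M :: "'f flag_graph"
  assumes simple: "simple_graph (flags M) (edges M)"
    and connected: "connected_graph (flags M) (edges M)"
    and colours: "e \<in> edges M \<Longrightarrow> colour M e \<in> {0..m}"
    and proper: "\<lbrakk>e \<in> edges M; e' \<in> edges M; e \<noteq> e'; e \<inter> e' \<noteq> {}\<rbrakk> \<Longrightarrow> colour M e \<noteq> colour M e'"
    and matching: "i \<in> {0..m} \<Longrightarrow> perfect_matching (flags M) (colour_class M i)"
    and squares: "\<lbrakk>i \<in> {0..m}; j \<in> {0..m}; \<bar>int i - int j\<bar> \<ge> 2; v \<in> flags M\<rbrakk> \<Longrightarrow>
      four_cycle (component_verts (colour_class M i \<union> colour_class M j) v)
                 (component_edges (colour_class M i \<union> colour_class M j) v)"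

text \<open>The chosen 2-colouring is recorded by its set of black flags; the other flags are white.\<close>

locale oriented_maniplex = maniplex +
  fixes black :: "'f set"
  assumes black_flags: "black \<subseteq> flags M"
    and two_colouring: "bipartition (flags M) (edges M) black (flags M - black)"

text \<open>
  As in \<open>BijGroup\<close>, automorphisms are extensional outside the set of flags.
\<close>

definition is_aut :: "'f flag_graph \<Rightarrow> ('f \<Rightarrow> 'f) \<Rightarrow> bool" where
  "is_aut M \<phi> \<longleftrightarrow> \<phi> \<in> Bij (flags M) \<and>
     (\<forall>u\<in>flags M. \<forall>v\<in>flags M. {u, v} \<in> edges M \<longleftrightarrow> {\<phi> u, \<phi> v} \<in> edges M) \<and>
     (\<forall>e\<in>edges M. colour M (\<phi> ` e) = colour M e)"

definition Aut :: "'f flag_graph \<Rightarrow> ('f \<Rightarrow> 'f) monoid" where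
  "Aut M = (BijGroup (flags M))\<lparr>carrier := {\<phi>. is_aut M \<phi>}\<rparr>"

definition Aut_plus :: "'f flag_graph \<Rightarrow> 'f set \<Rightarrow> ('f \<Rightarrow> 'f) monoid" where
  "Aut_plus M black =
     (BijGroup (flags M))\<lparr>carrier := {\<phi>. is_aut M \<phi> \<and> \<phi> ` black \<subseteq> black}\<rparr>"

section \<open>Symmetry type graphs\<close>

text \<open>
  Edge-coloured pregraphs: a link \<open>(a, {B, C})\<close> is an edge of colour \<open>a\<close> joining the distinct
  vertices \<open>B\<close> and \<open>C\<close>, and \<open>(a, B)\<close> in \<open>semi_edges\<close> is a semi-edge of colour \<open>a\<close> at \<open>B\<close>.
  Links of different colours with the same endpoints are different (parallel) edges.
\<close>

record 'v pregraph =
  verts :: "'v set"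
  links :: "(nat \<times> 'v set) set"
  semi_edges :: "(nat \<times> 'v) set"

text \<open>
  The cycle visits \<open>vs ! 0, vs ! 1, \<dots>\<close> in turn and \<open>es ! k\<close> is the link from \<open>vs ! k\<close> to its
  cyclic successor; no vertex and no link is repeated, and semi-edges are not used.
\<close>

definition pregraph_cycle :: "'v pregraph \<Rightarrow> 'v list \<Rightarrow> (nat \<times> 'v set) list \<Rightarrow> bool" where
  "pregraph_cycle T vs es \<longleftrightarrow>
     length vs \<ge> 2 \<and> length es = length vs \<and> distinct vs \<and> distinct es \<and>
     set vs \<subseteq> verts T \<and> set es \<subseteq> links T \<and>
     (\<forall>k < length vs. snd (es ! k) = {vs ! k, vs ! (Suc k mod length vs)})"

definition has_semi_edge :: "'v pregraph \<Rightarrow> bool" where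
  "has_semi_edge T \<longleftrightarrow> semi_edges T \<noteq> {}"

definition has_odd_cycle :: "'v pregraph \<Rightarrow> bool" where
  "has_odd_cycle T \<longleftrightarrow> (\<exists>vs es. pregraph_cycle T vs es \<and> odd (length es))"

definition symmetry_type_graph :: "'f flag_graph \<Rightarrow> 'f set pregraph" where
  "symmetry_type_graph M =
     (let Orb = orbits (Aut M) (flags M) (\<lambda>\<phi>. \<phi>) in
      \<lparr>verts = Orb,
       links = {(a, {B, C}) | a B C. B \<in> Orb \<and> C \<in> Orb \<and> B \<noteq> C \<and>
                  (\<exists>u\<in>B. \<exists>v\<in>C. {u, v} \<in> colour_class M a)},
       semi_edges = {(a, B) | a B. B \<in> Orb \<and>
                  (\<exists>u\<in>B. \<exists>v\<in>B. {u, v} \<in> colour_class M a)}\<rparr>)"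

text \<open>
  The vertex set of the oriented symmetry type di-graph. Its arcs play no role in counting
  vertices and are not modelled.
\<close>

definition oriented_symmetry_type_verts :: "'f flag_graph \<Rightarrow> 'f set \<Rightarrow> 'f set set" where
  "oriented_symmetry_type_verts M black = orbits (Aut_plus M black) black (\<lambda>\<phi>. \<phi>)"

end

theory Submission
  imports Defs
begin

text \<open>
  Everything reduces to whether some automorphism exchanges the two colours of flags. By
  connectedness an automorphism that preserves the colour of one flag preserves all colours. If
  some automorphism swaps the colours, then every orbit meets the black flags, and \<open>B \<mapsto> B \<inter> black\<close>
  is a bijection between the two kinds of orbits; a path from a flag \<open>u\<close> to a flag of the other
  colour in the orbit of \<open>u\<close> then projects to a closed walk of odd length in the symmetry type graph,
  which contains a semi-edge or an odd cycle. If no automorphism swaps the colours, then every orbit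
  is monochromatic: this 2-colours the symmetry type graph, and white orbits exist, so there are
  strictly fewer black orbits than orbits.
\<close>

section \<open>Odd closed walks\<close>

text \<open>A repeated vertex splits a closed walk into two shorter closed walks whose lengths add
  up to the original one, so one of them is again odd. The list leaves out the return to its head,
  so its length is the number of steps, the closing step included.\<close>

lemma odd_closed_walk_distinct:
  assumes "successively R vs" "vs \<noteq> []" "R (last vs) (hd vs)" "odd (length vs)"
  shows "\<exists>ws. successively R ws \<and> ws \<noteq> [] \<and> R (last ws) (hd ws) \<and> odd (length ws) \<and>
    distinct ws \<and> set ws \<subseteq> set vs"
  using assms
proof (induction "length vs" arbitrary: vs rule: less_induct)
  case less
  show ?case
  proof (cases "distinct vs")
    case True
    then show ?thesis using less.prems by blast
  next
    case False
    then obtain xs ys zs y where vs: "vs = xs @ [y] @ ys @ [y] @ zs"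
      using not_distinct_decomp by blast
    \<comment> \<open>Cut at the two visits of \<open>y\<close>: each piece keeps one copy of
      \<open>y\<close>, so no step is lost, and \<open>?outer\<close> has the same first and last
      entries as \<open>vs\<close>.\<close>
    let ?inner = "y # ys" and ?outer = "xs @ y # zs"
    have "successively R (xs @ ?inner @ y # zs)"
      using less.prems(1) by (simp add: vs)
    then have walk: "successively R xs" "successively R ?inner" "successively R (y # zs)"
      "xs = [] \<or> R (last xs) y" "R (last ?inner) y"
      by (simp_all only: successively_append_iff append_is_Nil_conv list.distinct list.sel hd_append
          if_False simp_thms)
    then have inner: "successively R ?inner" "R (last ?inner) (hd ?inner)"
      by simp_all
    have outer: "successively R ?outer"
      unfolding successively_append_iff using walk by (simp only: list.distinct list.sel simp_thms)
    have outer': "R (last ?outer) (hd ?outer)"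
      using less.prems(3) by (cases xs) (simp_all add: vs)
    have "odd (length ?inner) \<or> odd (length ?outer)"
      using less.prems(4) unfolding vs by auto
    then show ?thesis
    proof
      assume "odd (length ?inner)"
      moreover have "length ?inner < length vs" "?inner \<noteq> []" and sub: "set ?inner \<subseteq> set vs"
        by (auto simp: vs)
      ultimately show ?thesis
        using less.hyps[of ?inner] inner subset_trans[OF _ sub] by blast
    next
      assume "odd (length ?outer)"
      moreover have "length ?outer < length vs" "?outer \<noteq> []" and sub: "set ?outer \<subseteq> set vs"
        by (auto simp: vs)
      ultimately show ?thesis
        using less.hyps[of ?outer] outer outer' subset_trans[OF _ sub] by blast
    qed
  qed
qed

text \<open>This fails for \<open>n = 2\<close>, where two parallel links may join the same
  vertices. It serves to show that the links of a longer cycle are distinct.\<close>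

lemma not_mutual_cyclic_successors:
  fixes i j n :: nat
  assumes "3 \<le> n" "i < n" "j < n" "i = Suc j mod n"
  shows "j \<noteq> Suc i mod n"
proof -
  have succ: "Suc k = n \<and> Suc k mod n = 0 \<or> Suc k mod n = Suc k" if "k < n" for k
    using that by (cases "Suc k = n") auto
  show ?thesis
    using succ[OF assms(2)] succ[OF assms(3)] assms(1,4) by (elim disjE conjE) linarith+
qed

text \<open>After shortening to distinct vertices, irreflexivity of \<open>R\<close> excludes length
  1, so the odd length is at least 3. From there on, distinct vertices force distinct links.\<close>

lemma has_odd_cycle_of_odd_closed_walk:
  assumes R: "\<And>B C. R B C \<Longrightarrow> B \<noteq> C \<and> (\<exists>a. (a, {B, C}) \<in> links T)"
    and walk: "successively R vs" "vs \<noteq> []" "R (last vs) (hd vs)" "odd (length vs)"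
    and verts: "set vs \<subseteq> verts T"
  shows "has_odd_cycle T"
proof -
  obtain ws where ws: "successively R ws" "ws \<noteq> []" "R (last ws) (hd ws)" "odd (length ws)"
    "distinct ws" "set ws \<subseteq> set vs"
    using odd_closed_walk_distinct[OF walk] by blast
  define n where "n = length ws"
  have "n \<noteq> 1"
  proof
    assume "n = 1"
    then have "last ws = hd ws" by (cases ws) (auto simp: n_def)
    then show False using R ws(3) by metis
  qed
  moreover have "odd n"
    using ws by (simp add: n_def)
  ultimately have n: "n \<ge> 3"
    by presburger
  have step: "R (ws ! k) (ws ! (Suc k mod n))" if "k < n" for k
  proof (cases "Suc k = n")
    case True
    then have "k = n - 1" by simp
    then have "ws ! k = last ws" "ws ! (Suc k mod n) = hd ws"
      using ws(2) True by (simp_all add: last_conv_nth hd_conv_nth n_def del: One_nat_def)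
    then show ?thesis using ws(3) by simp
  next
    case False
    then show ?thesis using ws(1) that by (auto simp: successively_conv_nth n_def)
  qed
  \<comment> \<open>\<open>R\<close> records only that some link exists; a colour is now chosen for
    every step.\<close>
  have "\<forall>k. \<exists>a. k < n \<longrightarrow> (a, {ws ! k, ws ! (Suc k mod n)}) \<in> links T"
    using R[OF step] by blast
  then obtain a where a: "\<And>k. k < n \<Longrightarrow> (a k, {ws ! k, ws ! (Suc k mod n)}) \<in> links T"
    unfolding choice_iff by blast
  define es where "es = map (\<lambda>k. (a k, {ws ! k, ws ! (Suc k mod n)})) [0..<n]"
  \<comment> \<open>The links are told apart by their pairs of ends alone: two positions with the
    same pair would be cyclic successors of each other.\<close>
  have "i = j" if "i < n" "j < n" "{ws ! i, ws ! (Suc i mod n)} = {ws ! j, ws ! (Suc j mod n)}"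
    for i j
  proof (rule ccontr)
    assume "i \<noteq> j"
    then have "ws ! i \<noteq> ws ! j"
      using ws(5) that by (simp add: nth_eq_iff_index_eq n_def)
    then have "ws ! i = ws ! (Suc j mod n)" "ws ! j = ws ! (Suc i mod n)"
      using that(3) by (auto simp: doubleton_eq_iff)
    then have "i = Suc j mod n" "j = Suc i mod n"
      using nth_eq_iff_index_eq[OF ws(5), folded n_def] that(1,2) mod_less_divisor[of n] n
      by (metis gr_zeroI not_less_zero)+
    then show False
      using not_mutual_cyclic_successors n that(1,2) by blast
  qed
  then have "distinct es"
    by (auto simp: es_def distinct_map intro!: inj_onI)
  then have "pregraph_cycle T ws es"
    using n ws(5,6) verts a unfolding pregraph_cycle_def
    by (auto simp: es_def n_def[symmetric])
  moreover have "odd (length es)"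
    using \<open>odd n\<close> by (simp add: es_def)
  ultimately show ?thesis
    unfolding has_odd_cycle_def by blast
qed

lemma not_has_odd_cycle_if_two_colouring:
  assumes c: "\<And>a B C. (a, {B, C}) \<in> links T \<Longrightarrow> c C \<longleftrightarrow> \<not> c B"
  shows "\<not> has_odd_cycle T"
proof
  assume "has_odd_cycle T"
  then obtain vs es where cyc: "pregraph_cycle T vs es" and odd: "odd (length es)"
    unfolding has_odd_cycle_def by blast
  define n where "n = length vs"
  have n: "n \<ge> 2" "odd n"
    using cyc odd by (auto simp: pregraph_cycle_def n_def)
  have step: "c (vs ! (Suc k mod n)) \<longleftrightarrow> \<not> c (vs ! k)" if "k < n" for k
  proof -
    have "es ! k \<in> links T" "snd (es ! k) = {vs ! k, vs ! (Suc k mod n)}"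
      using cyc that by (auto simp: pregraph_cycle_def n_def)
    then show ?thesis using c by (metis prod.collapse)
  qed
  have alt: "c (vs ! k) \<longleftrightarrow> (c (vs ! 0) \<longleftrightarrow> even k)" if "k < n" for k
    using that
  proof (induction k)
    case (Suc k)
    then show ?case using step[of k] by auto
  qed simp
  \<comment> \<open>The last vertex has even index, hence the colour of the first one, yet the
    closing link makes these colours differ.\<close>
  have "even (n - 1)" "n - 1 < n" "Suc (n - 1) mod n = 0"
    using n by auto
  then show False
    using alt[of "n - 1"] step[of "n - 1"] by auto
qed

section \<open>Automorphisms and their orbits\<close>

lemma is_aut_in_flags: "is_aut M \<phi> \<Longrightarrow> u \<in> flags M \<Longrightarrow> \<phi> u \<in> flags M"
  by (auto simp: is_aut_def Bij_def bij_betw_def)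

lemma is_aut_restrict_id: "is_aut M (\<lambda>x\<in>flags M. x)" if "simple_graph (flags M) (edges M)"
proof -
  have "(\<lambda>x\<in>flags M. x) ` e = e" if "e \<subseteq> flags M" for e
    using that by force
  then show ?thesis
    using that by (auto simp: is_aut_def id_Bij simple_graph_def)
qed

lemma is_aut_image_edge:
  assumes "simple_graph (flags M) (edges M)" "is_aut M \<phi>" "e \<in> edges M"
  shows "\<phi> ` e \<in> edges M"
proof -
  obtain u v where "e = {u, v}" "u \<in> flags M" "v \<in> flags M"
    using assms(1,3) by (fastforce simp: simple_graph_def card_2_iff)
  then show ?thesis using assms(2,3) by (auto simp: is_aut_def)
qed

lemma is_aut_compose:
  assumes "simple_graph (flags M) (edges M)" "is_aut M \<phi>" "is_aut M \<psi>"
  shows "is_aut M (compose (flags M) \<phi> \<psi>)"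
proof -
  have "compose (flags M) \<phi> \<psi> ` e = \<phi> ` \<psi> ` e" if "e \<in> edges M" for e
    using assms(1) that by (force simp: simple_graph_def compose_def)
  then have "\<forall>e\<in>edges M. colour M (compose (flags M) \<phi> \<psi> ` e) = colour M e"
    using assms is_aut_image_edge[OF assms(1,3)] by (auto simp: is_aut_def)
  moreover have "compose (flags M) \<phi> \<psi> \<in> Bij (flags M)"
    using assms by (auto simp: is_aut_def intro: compose_Bij)
  ultimately show ?thesis
    using assms is_aut_in_flags[OF assms(3)] by (auto simp: is_aut_def compose_eq)
qed

lemma is_aut_inverse:
  assumes "simple_graph (flags M) (edges M)" "is_aut M \<phi>"
  defines "\<psi> \<equiv> (\<lambda>x\<in>flags M. inv_into (flags M) \<phi> x)"
  shows "is_aut M \<psi>"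
proof -
  have bij: "bij_betw \<phi> (flags M) (flags M)"
    using assms(2) by (auto simp: is_aut_def Bij_def)
  have in_flags: "\<psi> x \<in> flags M" and right_inv: "\<phi> (\<psi> x) = x" if "x \<in> flags M" for x
    using that bij by (auto simp: \<psi>_def bij_betw_def inv_into_into f_inv_into_f)
  have "\<psi> \<in> Bij (flags M)"
    using assms(2) by (auto simp: is_aut_def \<psi>_def intro: restrict_inv_into_Bij)
  moreover have adj: "{u, v} \<in> edges M \<longleftrightarrow> {\<psi> u, \<psi> v} \<in> edges M"
    if "u \<in> flags M" "v \<in> flags M" for u v
    using assms(2) that in_flags right_inv unfolding is_aut_def by metis
  moreover have "colour M (\<psi> ` e) = colour M e" if e: "e \<in> edges M" for e
  proof -
    obtain u v where uv: "e = {u, v}" "u \<in> flags M" "v \<in> flags M"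
      using assms(1) e by (fastforce simp: simple_graph_def card_2_iff)
    then have "\<psi> ` e \<in> edges M" "\<phi> ` \<psi> ` e = e"
      using e adj[of u v] right_inv by auto
    then show ?thesis
      using assms(2) by (metis is_aut_def)
  qed
  ultimately show ?thesis
    by (auto simp: is_aut_def)
qed

lemma orbit_Aut: "orbit (Aut M) (\<lambda>\<phi>. \<phi>) u = {\<phi> u | \<phi>. is_aut M \<phi>}"
  by (auto simp: orbit_def Aut_def)

lemma orbit_Aut_plus:
  "orbit (Aut_plus M black) (\<lambda>\<phi>. \<phi>) u = {\<phi> u | \<phi>. is_aut M \<phi> \<and> \<phi> ` black \<subseteq> black}"
  by (auto simp: orbit_def Aut_plus_def)

section \<open>Flag orbits and the symmetry type graph\<close>

context maniplex
begin

abbreviation orb :: "'f \<Rightarrow> 'f set" where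
  "orb u \<equiv> orbit (Aut M) (\<lambda>\<phi>. \<phi>) u"

lemma edge_in_flags: "{u, v} \<in> edges M \<Longrightarrow> u \<in> flags M \<and> v \<in> flags M"
  using simple by (auto simp: simple_graph_def)

lemma orb_refl: "u \<in> flags M \<Longrightarrow> u \<in> orb u"
  using is_aut_restrict_id[OF simple] unfolding orbit_Aut by (metis (mono_tags, lifting) CollectI restrict_apply')

lemma orb_subset: "u \<in> flags M \<Longrightarrow> orb u \<subseteq> flags M"
  by (auto simp: orbit_Aut is_aut_in_flags)

lemma orb_sym:
  assumes "u \<in> flags M" "v \<in> orb u"
  shows "u \<in> orb v"
proof -
  obtain \<phi> where \<phi>: "is_aut M \<phi>" "v = \<phi> u"
    using assms by (auto simp: orbit_Aut)
  then have "inv_into (flags M) \<phi> v = u" "v \<in> flags M"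
    using assms(1) by (auto simp: is_aut_def Bij_def bij_betw_def)
  then have "(\<lambda>x\<in>flags M. inv_into (flags M) \<phi> x) v = u" by simp
  then show ?thesis
    using is_aut_inverse[OF simple \<phi>(1)] unfolding orbit_Aut by blast
qed

lemma orb_trans:
  assumes "u \<in> flags M" "v \<in> orb u" "w \<in> orb v"
  shows "w \<in> orb u"
proof -
  obtain \<phi> \<psi> where "is_aut M \<phi>" "is_aut M \<psi>" "w = \<phi> (\<psi> u)"
    using assms by (auto simp: orbit_Aut)
  then have "is_aut M (compose (flags M) \<phi> \<psi>)" "w = compose (flags M) \<phi> \<psi> u"
    using is_aut_compose[OF simple] assms(1) by (simp_all add: compose_eq)
  then show ?thesis
    unfolding orbit_Aut by blast
qed

lemma orb_eq:
  assumes "u \<in> flags M" "v \<in> orb u"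
  shows "orb v = orb u"
  using assms orb_sym orb_trans orb_subset by blast

lemma verts_symmetry_type_graph: "verts (symmetry_type_graph M) = orb ` flags M"
  by (auto simp: symmetry_type_graph_def Let_def orbits_def)

lemma link_between_orbits:
  assumes "{u, v} \<in> edges M" "orb u \<noteq> orb v"
  shows "(colour M {u, v}, {orb u, orb v}) \<in> links (symmetry_type_graph M)"
proof -
  have "{u, v} \<in> colour_class M (colour M {u, v})"
    using assms by (auto simp: colour_class_def)
  moreover have "u \<in> orb u" "v \<in> orb v"
    using assms edge_in_flags orb_refl by blast+
  ultimately show ?thesis
    using assms edge_in_flags unfolding symmetry_type_graph_def Let_def orbits_def
    by (simp, blast)
qed

text \<open>Used in both directions: in the absence of semi-edges every edge of the flag graph
  projects to a link.\<close>

lemma has_semi_edge_iff: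
  "has_semi_edge (symmetry_type_graph M) \<longleftrightarrow> (\<exists>u v. {u, v} \<in> edges M \<and> orb u = orb v)"
proof
  assume "has_semi_edge (symmetry_type_graph M)"
  then obtain w u v a where "w \<in> flags M" "u \<in> orb w" "v \<in> orb w" "{u, v} \<in> colour_class M a"
    by (auto simp: has_semi_edge_def symmetry_type_graph_def Let_def orbits_def)
  then show "\<exists>u v. {u, v} \<in> edges M \<and> orb u = orb v"
    using orb_eq[of w u] orb_eq[of w v] by (auto simp: colour_class_def)
next
  assume "\<exists>u v. {u, v} \<in> edges M \<and> orb u = orb v"
  then obtain u v where uv: "{u, v} \<in> edges M" "orb u = orb v" by blast
  then have "u \<in> flags M" "u \<in> orb u" "v \<in> orb u"
    using edge_in_flags orb_refl by auto
  moreover have "{u, v} \<in> colour_class M (colour M {u, v})"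
    using uv by (auto simp: colour_class_def)
  ultimately show "has_semi_edge (symmetry_type_graph M)"
    unfolding has_semi_edge_def symmetry_type_graph_def Let_def orbits_def
    by (simp, blast)
qed

end

section \<open>Flag colours under automorphisms\<close>

context oriented_maniplex
begin

lemma edge_two_coloured: "{u, v} \<in> edges M \<Longrightarrow> v \<in> black \<longleftrightarrow> u \<notin> black"
  using two_colouring unfolding bipartition_def by (fastforce simp: doubleton_eq_iff)

text \<open>The end \<open>v\<close> is kept apart so that \<open>length xs\<close> counts the steps
  and \<open>xs\<close> alone can later be projected to a closed walk. Each step changes the colour,
  which gives the parity.\<close>

lemma flag_walk:
  assumes "(u, v) \<in> (adj_rel (edges M))\<^sup>*"
  shows "\<exists>xs. successively (\<lambda>x y. {x, y} \<in> edges M) (xs @ [v]) \<and> hd (xs @ [v]) = u \<and>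
    (even (length xs) \<longleftrightarrow> (u \<in> black \<longleftrightarrow> v \<in> black))"
  using assms
proof (induction rule: rtrancl_induct)
  case base
  show ?case by (intro exI[of _ "[]"]) auto
next
  case (step v w)
  then obtain xs where xs: "successively (\<lambda>x y. {x, y} \<in> edges M) (xs @ [v])" "hd (xs @ [v]) = u"
    "even (length xs) \<longleftrightarrow> (u \<in> black \<longleftrightarrow> v \<in> black)" by blast
  have vw: "{v, w} \<in> edges M" using step by (simp add: adj_rel_def)
  have "successively (\<lambda>x y. {x, y} \<in> edges M) ((xs @ [v]) @ [w])"
    using xs(1) vw by (subst successively_append_iff) auto
  moreover have "hd ((xs @ [v]) @ [w]) = u"
    using xs(2) by (cases xs) auto
  moreover have "even (length (xs @ [v])) \<longleftrightarrow> (u \<in> black \<longleftrightarrow> w \<in> black)"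
    using xs(3) edge_two_coloured[OF vw] by auto
  ultimately show ?case by blast
qed

text \<open>An edge and its image both join opposite colours, so keeping or changing the colour
  passes from a flag to its neighbours and, by connectedness, to all flags.\<close>

lemma is_aut_colour_uniform:
  assumes "is_aut M \<phi>" "u \<in> flags M" "v \<in> flags M"
  shows "(\<phi> u \<in> black \<longleftrightarrow> u \<in> black) \<longleftrightarrow> (\<phi> v \<in> black \<longleftrightarrow> v \<in> black)"
proof -
  have "(u, v) \<in> (adj_rel (edges M))\<^sup>*"
    using connected assms by (auto simp: connected_graph_def)
  then show ?thesis
  proof (induction rule: rtrancl_induct)
    case (step v w)
    then have "{v, w} \<in> edges M" by (simp add: adj_rel_def)
    moreover from this have "{\<phi> v, \<phi> w} \<in> edges M"
      using is_aut_image_edge[OF simple assms(1)] by fastforce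
    ultimately show ?case
      using step.IH edge_two_coloured by blast
  qed simp
qed

lemma is_aut_preserves_black:
  assumes "is_aut M \<phi>" "u \<in> black" "\<phi> u \<in> black"
  shows "\<phi> ` black \<subseteq> black"
  using is_aut_colour_uniform[OF assms(1), of u] assms black_flags by blast

text \<open>An automorphism taking the black flag \<open>u\<close> to a black flag preserves all
  black flags, so it already lies in \<open>Aut_plus\<close>.\<close>

lemma orbit_Aut_plus_eq:
  assumes "u \<in> black"
  shows "orbit (Aut_plus M black) (\<lambda>\<phi>. \<phi>) u = orb u \<inter> black"
  using assms is_aut_preserves_black unfolding orbit_Aut orbit_Aut_plus by blast

lemma oriented_symmetry_type_verts_eq:
  "oriented_symmetry_type_verts M black = (\<lambda>B. B \<inter> black) ` (orb ` black)"
  using orbit_Aut_plus_eq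
  by (auto simp: oriented_symmetry_type_verts_def orbits_def image_iff)

lemma card_oriented_symmetry_type_verts:
  "card (oriented_symmetry_type_verts M black) = card (orb ` black)"
proof -
  \<comment> \<open>An orbit is recovered from its black part as the orbit of any flag in
    it.\<close>
  have "inj_on (\<lambda>B. B \<inter> black) (orb ` black)"
  proof (rule inj_onI, clarify)
    fix u v assume uv: "u \<in> black" "v \<in> black" "orb u \<inter> black = orb v \<inter> black"
    then have "v \<in> orb u" "u \<in> flags M" using orb_refl black_flags by blast+
    then show "orb u = orb v" using orb_eq by blast
  qed
  then show ?thesis
    by (simp add: oriented_symmetry_type_verts_eq card_image)
qed

text \<open>The pivot to which both sides of the theorem are compared. By
  \<open>is_aut_colour_uniform\<close>, one such flag yields an automorphism that changes the colour
  of every flag.\<close>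

definition swapping :: bool where
  "swapping \<longleftrightarrow> (\<exists>u\<in>flags M. \<exists>v\<in>orb u. v \<in> black \<longleftrightarrow> u \<notin> black)"

lemma swapping_orb_meets:
  assumes "swapping" "u \<in> flags M"
  obtains v where "v \<in> orb u" "v \<in> black \<longleftrightarrow> u \<notin> black"
proof -
  obtain w \<phi> where "w \<in> flags M" "is_aut M \<phi>" "\<phi> w \<in> black \<longleftrightarrow> w \<notin> black"
    using assms(1) by (auto simp: swapping_def orbit_Aut)
  then have "is_aut M \<phi>" "\<phi> u \<in> black \<longleftrightarrow> u \<notin> black"
    using is_aut_colour_uniform assms(2) by blast+
  then show thesis using that by (auto simp: orbit_Aut)
qed

text \<open>Colour 0 is available for every \<open>m\<close>, so any flag lies on an edge, and that
  edge has a white end.\<close>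

lemma white_flag:
  obtains w where "w \<in> flags M - black"
proof -
  obtain v where v: "v \<in> flags M"
    using connected by (auto simp: connected_graph_def)
  then obtain e where "e \<in> edges M"
    using matching[of 0] by (force simp: perfect_matching_def colour_class_def)
  then show thesis
    using two_colouring that unfolding bipartition_def by blast
qed

text \<open>The orbits of black flags are among all orbits, so by finiteness equal cardinality means
  equality of the two sets. If they are equal, the orbit of a white flag contains a black
  one.\<close>

lemma card_verts_eq_iff_swapping:
  assumes "finite (verts (symmetry_type_graph M))"
  shows "card (verts (symmetry_type_graph M)) = card (oriented_symmetry_type_verts M black)
    \<longleftrightarrow> swapping"
proof -
  have fin: "finite (orb ` flags M)" and sub: "orb ` black \<subseteq> orb ` flags M"
    using assms black_flags by (auto simp: verts_symmetry_type_graph)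
  have "orb ` flags M = orb ` black \<longleftrightarrow> swapping"
  proof
    obtain w where w: "w \<in> flags M" "w \<notin> black" using white_flag by blast
    assume "orb ` flags M = orb ` black"
    then obtain u where "u \<in> black" "orb u = orb w" using w by (metis image_iff)
    then show swapping
      using w orb_refl black_flags unfolding swapping_def by blast
  next
    assume swapping
    then have "orb u \<in> orb ` black" if "u \<in> flags M" for u
      using swapping_orb_meets[OF _ that] orb_eq[OF that] by (metis image_eqI)
    then show "orb ` flags M = orb ` black"
      using sub by blast
  qed
  moreover have "card (orb ` flags M) = card (orb ` black) \<longleftrightarrow> orb ` flags M = orb ` black"
    using fin sub card_subset_eq by metis
  ultimately show ?thesis
    by (simp add: verts_symmetry_type_graph card_oriented_symmetry_type_verts)
qed

lemma semi_edge_or_odd_cycle_iff_swapping: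
  "has_semi_edge (symmetry_type_graph M) \<or> has_odd_cycle (symmetry_type_graph M) \<longleftrightarrow> swapping"
proof
  assume swapping
  then obtain u v where uv: "u \<in> flags M" "v \<in> orb u" "v \<in> black \<longleftrightarrow> u \<notin> black"
    by (auto simp: swapping_def)
  then have "(u, v) \<in> (adj_rel (edges M))\<^sup>*"
    using connected orb_subset by (auto simp: connected_graph_def)
  then obtain xs where xs: "successively (\<lambda>x y. {x, y} \<in> edges M) (xs @ [v])"
    "hd (xs @ [v]) = u" "odd (length xs)"
    using flag_walk uv(3) by blast
  then have ne: "xs \<noteq> []" by auto
  define adj where "adj B C \<longleftrightarrow> B \<noteq> C \<and> (\<exists>a. (a, {B, C}) \<in> links (symmetry_type_graph M))" for B C
  show "has_semi_edge (symmetry_type_graph M) \<or> has_odd_cycle (symmetry_type_graph M)"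
  \<comment> \<open>Without semi-edges, consecutive flags of the walk lie in different orbits, so
    the walk projects step by step.\<close>
  proof (subst disj_commute, rule disjCI)
    assume "\<not> has_semi_edge (symmetry_type_graph M)"
    then have proj: "adj (orb x) (orb y)" if "{x, y} \<in> edges M" for x y
      using that link_between_orbits unfolding has_semi_edge_iff adj_def by blast
    have "successively (\<lambda>x y. {x, y} \<in> edges M) xs" and last: "{last xs, v} \<in> edges M"
      using xs(1) ne by (auto simp: successively_append_iff)
    then have "successively adj (map orb xs)"
      unfolding successively_map using proj by (metis (no_types, lifting) successively_mono)
    \<comment> \<open>The edge from \<open>last xs\<close> to \<open>v\<close> closes the projected
      walk, because \<open>orb v = orb u\<close>.\<close>
    moreover have "adj (last (map orb xs)) (hd (map orb xs))"
      using proj[OF last] xs(2) ne orb_eq[OF uv(1,2)] by (simp add: last_map hd_map)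
    moreover have "set (map orb xs) \<subseteq> verts (symmetry_type_graph M)"
    proof -
      \<comment> \<open>Every entry of \<open>xs\<close> has a successor in the walk, the last one
        having \<open>v\<close>, so it is an end of an edge.\<close>
      have "x \<in> flags M" if "x \<in> set xs" for x
      proof -
        obtain ys zs where "xs = ys @ x # zs" using split_list[OF \<open>x \<in> set xs\<close>] by blast
        then have "{x, hd (zs @ [v])} \<in> edges M"
          using xs(1) by (cases zs) (auto simp: successively_append_iff)
        then show ?thesis using edge_in_flags by blast
      qed
      then show ?thesis by (auto simp: verts_symmetry_type_graph)
    qed
    ultimately show "has_odd_cycle (symmetry_type_graph M)"
      using has_odd_cycle_of_odd_closed_walk[of adj _ "map orb xs"] ne xs(3)
      by (auto simp: adj_def)
  qed
next
  assume "has_semi_edge (symmetry_type_graph M) \<or> has_odd_cycle (symmetry_type_graph M)"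
  then show swapping
  proof
    assume "has_semi_edge (symmetry_type_graph M)"
    then obtain u v where "{u, v} \<in> edges M" "orb u = orb v"
      using has_semi_edge_iff by blast
    then show swapping
      using edge_two_coloured edge_in_flags orb_refl unfolding swapping_def by metis
  next
    assume cycle: "has_odd_cycle (symmetry_type_graph M)"
    show swapping
    proof (rule ccontr)
      assume "\<not> swapping"
      then have mono: "v \<in> black \<longleftrightarrow> u \<in> black" if "w \<in> flags M" "u \<in> orb w" "v \<in> orb w" for u v w
        using that unfolding swapping_def by blast
      \<comment> \<open>Orbits are nonempty and now monochromatic, so being contained in
        \<open>black\<close> is a 2-colouring of the symmetry type graph.\<close>
      have "C \<subseteq> black \<longleftrightarrow> \<not> B \<subseteq> black"
        if link: "(a, {B, C}) \<in> links (symmetry_type_graph M)" for a B C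
      proof -
        obtain x y u v where BC: "{B, C} = {orb x, orb y}" "x \<in> flags M" "y \<in> flags M"
          and uv: "u \<in> orb x" "v \<in> orb y" "{u, v} \<in> edges M"
          using link
          by (auto simp: symmetry_type_graph_def Let_def orbits_def colour_class_def)
        then have "orb x \<subseteq> black \<longleftrightarrow> u \<in> black" "orb y \<subseteq> black \<longleftrightarrow> v \<in> black"
          using mono by blast+
        then show ?thesis
          using edge_two_coloured[OF uv(3)] BC(1) by (auto simp: doubleton_eq_iff)
      qed
      then show False
        using not_has_odd_cycle_if_two_colouring[of _ "\<lambda>B. B \<subseteq> black"] cycle by blast
    qed
  qed
qed

end

theorem theorem6p3:
  fixes m :: nat and M :: "'f flag_graph" and black :: "'f set"
  assumes "oriented_maniplex m M black"
    and "finite (verts (symmetry_type_graph M))"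
  shows "card (verts (symmetry_type_graph M)) = card (oriented_symmetry_type_verts M black) \<longleftrightarrow>
    has_semi_edge (symmetry_type_graph M) \<or> has_odd_cycle (symmetry_type_graph M)"
proof -
  interpret oriented_maniplex m M black by fact
  show ?thesis
    using card_verts_eq_iff_swapping[OF assms(2)] semi_edge_or_odd_cycle_iff_swapping by simp
qed

end
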